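(* Let $\mathsf{GHZ}^n$ denote the $n$-fold parallel repetition of the GHZ game (defined in the context). There exist absolute constants $c>0$ and $n_0\in\mathbb{N}$ such that for all $n\ge n_0$, the value of $\mathsf{GHZ}^n$ is at most $n^{-c}$. (That is, $\mathsf{val}(\mathsf{GHZ}^n)\le n^{-\Omega(1)}$.)
   Context: The GHZ game is the 3-player game in which a referee samples a query $(q_1,q_2,q_3)$ uniformly from $\{(0,0,0),(0,1,1),(1,0,1),(1,1,0)\}\subseteq \mathbb{F}_2^3$ and sends $q_j$ to player $j$; each player $j$ returns an answer $a_j\in\mathbb{F}_2$ depending only on $q_j$; the players win iff $a_1+a_2+a_3 \equiv q_1\lor q_2\lor q_3 \pmod 2$. The $n$-fold parallel repetition: the referee samples $n$ independent queries $(q_1^i,q_2^i,q_3^i)$, $i\in[n]$, from this distribution; player $j$ receives $(q_j^1,\dots,q_j^n)$ and outputs $(a_j^1,\dots,a_j^n)\in\mathbb{F}_2^n$ as a function of its own input only; the players win iff they win the GHZ game in every coordinate $i\in[n]$. The value of a game is the maximum, over all deterministic strategies $f=f_1\times f_2\times f_3$ (each $f_j$ a function from player $j$'s inputs to its answers), of the probability of winning. *)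

theory Defs
  imports "HOL-Probability.Probability" "HOL-Probability.Product_PMF" "HOL-Library.Z2"
begin

text \<open>
  Three-player one-round games. The query alphabet \<open>'q\<close> and the answer alphabet \<open>'a\<close> are full
  types, the same for all players.
\<close>

record ('q, 'a) game3 =
  query_dist :: "('q \<times> 'q \<times> 'q) pmf"
  wins :: "'q \<times> 'q \<times> 'q \<Rightarrow> 'a \<times> 'a \<times> 'a \<Rightarrow> bool"

definition win_prob ::
  "('q, 'a) game3 \<Rightarrow> ('q \<Rightarrow> 'a) \<Rightarrow> ('q \<Rightarrow> 'a) \<Rightarrow> ('q \<Rightarrow> 'a) \<Rightarrow> real" where
  "win_prob G f1 f2 f3 =
     measure_pmf.prob (query_dist G) {(q1, q2, q3). wins G (q1, q2, q3) (f1 q1, f2 q2, f3 q3)}"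

text \<open>The supremum is a maximum for finitely supported queries: see \<open>game_value_attained\<close>.\<close>

definition game_value :: "('q, 'a) game3 \<Rightarrow> real" where
  "game_value G = (SUP (f1, f2, f3) \<in> UNIV. win_prob G f1 f2 f3)"

text \<open>
  Vectors with \<open>n\<close> coordinates are functions on \<open>nat\<close> read on \<open>{..<n}\<close>. A player's input is
  \<open>undefined\<close> outside \<open>{..<n}\<close>, so it carries no further information; the values of an answer
  vector outside \<open>{..<n}\<close> are ignored.
\<close>

definition parallel_rep :: "nat \<Rightarrow> ('q, 'a) game3 \<Rightarrow> (nat \<Rightarrow> 'q, nat \<Rightarrow> 'a) game3" where
  "parallel_rep n G = \<lparr>
     query_dist =
       map_pmf (\<lambda>q. (\<lambda>i\<in>{..<n}. fst (q i), \<lambda>i\<in>{..<n}. fst (snd (q i)), \<lambda>i\<in>{..<n}. snd (snd (q i))))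
         (Pi_pmf {..<n} undefined (\<lambda>_. query_dist G)),
     wins = (\<lambda>(q1, q2, q3) (a1, a2, a3).
       \<forall>i<n. wins G (q1 i, q2 i, q3 i) (a1 i, a2 i, a3 i)) \<rparr>"

definition GHZ :: "(bit, bit) game3" where
  "GHZ = \<lparr>
     query_dist = pmf_of_set {(0, 0, 0), (0, 1, 1), (1, 0, 1), (1, 1, 0)},
     wins = (\<lambda>(q1, q2, q3) (a1, a2, a3).
       a1 + a2 + a3 = of_bool (q1 = 1 \<or> q2 = 1 \<or> q3 = 1)) \<rparr>"

lemma game_value_attained:
  assumes "finite (set_pmf (query_dist G))"
  shows "\<exists>f1 f2 f3. game_value G = win_prob G f1 f2 f3"
proof -
  let ?p = "query_dist G"
  let ?S = "(\<lambda>(f1, f2, f3). win_prob G f1 f2 f3) ` UNIV"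
  have "?S \<subseteq> measure_pmf.prob ?p ` Pow (set_pmf ?p)"
  proof
    fix x assume "x \<in> ?S"
    then obtain A where "x = measure_pmf.prob ?p A"
      by (auto simp: win_prob_def)
    then have "x = measure_pmf.prob ?p (A \<inter> set_pmf ?p)"
      by (simp add: measure_Int_set_pmf)
    then show "x \<in> measure_pmf.prob ?p ` Pow (set_pmf ?p)" by blast
  qed
  then have "finite ?S" using assms by (meson finite_Pow_iff finite_imageI finite_subset)
  then have "Sup ?S \<in> ?S" by (metis Max_in cSup_eq_Max UNIV_not_empty image_is_empty)
  then show ?thesis by (auto simp: game_value_def)
qed

lemma game_value_GHZ_rep_attained:
  "\<exists>f1 f2 f3. game_value (parallel_rep n GHZ) = win_prob (parallel_rep n GHZ) f1 f2 f3"
  by (rule game_value_attained)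
     (auto simp: parallel_rep_def GHZ_def set_Pi_pmf intro!: finite_imageI finite_PiE_dflt)

end

theory Submission
  imports Defs "HOL-Library.Function_Algebras" "HOL-Library.Set_Algebras" "HOL-Library.Numeral_Type"
begin

text \<open>
  Write \<open>F x = 2 f\<^sub>1(x) - x\<close> in \<open>\<int>\<^sub>4\<^sup>n\<close>, and \<open>G\<close>, \<open>H\<close> likewise for the other players. The players win
  on \<open>(x, y, x + y)\<close> iff \<open>F x + G y + H (x + y) = 0\<close>. If this happens for a fraction \<open>\<epsilon>\<close> of the
  pairs \<open>(x, y)\<close>, the argument of Balog, Szemeredi and Gowers yields a set \<open>S\<close> of density at least
  \<open>\<epsilon> / 4\<close> in \<open>{0, 1}\<^sup>n\<close> with \<open>|F S - F S| \<le> K |S|\<close>, where \<open>K\<close> is polynomial in \<open>1 / \<epsilon>\<close>.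
  But \<open>F\<close> is a section of the reduction mod 2, so \<open>F x - 2 F y\<close> determines first \<open>x\<close> and then
  \<open>2 F y\<close>, that is \<open>y\<close>; together with Petridis' form of the Pluennecke inequality this gives
  \<open>|S| \<le> K\<^sup>2\<close>. Hence \<open>\<epsilon>\<close> is even exponentially small in \<open>n\<close>.
\<close>

section \<open>Sumset inequalities in abelian groups\<close>

text \<open>\<open>X\<close> minimises the expansion ratio |Y + B| / |Y| over nonempty subsets
  \<open>Y\<close> of \<open>A\<close>. Inserting an element into \<open>C\<close> then enlarges
  \<open>X + B + C\<close> by at most this ratio times the growth of \<open>X + C\<close>, which
  drives an induction on \<open>C\<close>.\<close>

lemma petridis:
  fixes A B :: "'a::ab_group_add set"
  assumes "finite A" "A \<noteq> {}" "finite B"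
  obtains X where "X \<subseteq> A" "X \<noteq> {}" "card (X + B) * card A \<le> card (A + B) * card X"
    and "\<And>C. finite C \<Longrightarrow> card (X + B + C) * card X \<le> card (X + B) * card (X + C)"
proof -
  define r where "r Y = real (card (Y + B)) / real (card Y)" for Y :: "'a set"
  have "finite (Pow A - {{}})" "Pow A - {{}} \<noteq> {}" using assms by auto
  from ex_min_if_finite[OF finite_imageI[OF this(1)], of r] this(2)
  obtain X where X: "X \<subseteq> A" "X \<noteq> {}" and min: "\<And>Y. Y \<subseteq> A \<Longrightarrow> Y \<noteq> {} \<Longrightarrow> r X \<le> r Y"
    by (auto simp: not_less) 
  have finX: "finite X" using X assms finite_subset by blast
  have cX: "card X > 0" using finX X by (simp add: card_gt_0_iff)
  have ratio: "card (X + B) * card Y \<le> card (Y + B) * card X" if "Y \<subseteq> A" for Y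
  proof (cases "Y = {}")
    case False
    then have "card Y > 0" using that assms(1) finite_subset by (auto simp: card_gt_0_iff)
    with min[OF that False] cX show ?thesis
      by (simp add: r_def field_simps flip: of_nat_mult)
  qed simp
  have "card (X + B + C) * card X \<le> card (X + B) * card (X + C)" if "finite C" for C
    using that
  proof (induction C)
    case empty
    then show ?case by (simp add: set_plus_def)
  next
    case (insert c C)
    \<comment> \<open>Points outside \<open>X1\<close> are the only source of new sums in
      \<open>X + B + insert c C\<close>, and each point outside \<open>X2\<close> yields a new
      element of \<open>X + insert c C\<close>. As \<open>X2\<close> lies in \<open>X1\<close>,
      minimality of the ratio at \<open>X1\<close> compares the two gains.\<close>
    define X1 where "X1 = {x \<in> X. \<forall>b\<in>B. x + b + c \<in> X + B + C}"
    define X2 where "X2 = {x \<in> X. x + c \<in> X + C}"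
    have fin: "finite (X + B + C)" "finite (X + B)" "finite (X + C)" "finite X1" "finite X2" "finite (X1 + B)"
      using finX assms(3) insert.hyps by (auto intro!: finite_set_plus simp: X1_def X2_def)
    have sub: "X2 \<subseteq> X1" "X1 \<subseteq> X"
    proof
      fix x assume "x \<in> X2"
      then obtain x' c' where x: "x \<in> X" "x' \<in> X" "c' \<in> C" "x + c = x' + c'"
        by (auto simp: X2_def elim!: set_plus_elim)
      have "x + b + c \<in> X + B + C" if "b \<in> B" for b
      proof -
        have "x + b + c = x' + b + c'" using x(4) by (metis add.assoc add.commute)
        then show ?thesis using set_plus_intro[OF set_plus_intro[OF x(2) that] x(3)] by metis
      qed
      then show "x \<in> X1" using x(1) by (auto simp: X1_def)
    qed (auto simp: X1_def)
    have "X + B + insert c C \<subseteq> (X + B + C) \<union> (\<lambda>s. s + c) ` ((X + B) - (X1 + B))"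
    proof
      fix s assume "s \<in> X + B + insert c C"
      then obtain t d where t: "t \<in> X + B" "d \<in> insert c C" "s = t + d"
        by (auto elim!: set_plus_elim)
      show "s \<in> (X + B + C) \<union> (\<lambda>s. s + c) ` ((X + B) - (X1 + B))"
      proof (cases "d = c \<and> t \<notin> X1 + B")
        case True
        then show ?thesis using t by auto
      next
        case False
        then have "s \<in> X + B + C"
        proof (cases "d = c")
          case True
          with False have "t \<in> X1 + B" by auto
          then show ?thesis using t True by (auto simp: X1_def elim!: set_plus_elim)
        next
          case False
          then show ?thesis using t by (auto intro!: set_plus_intro)
        qed
        then show ?thesis by simp
      qed
    qed
    then have "card (X + B + insert c C) \<le> card ((X + B + C) \<union> (\<lambda>s. s + c) ` ((X + B) - (X1 + B)))"
      using fin by (intro card_mono) auto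
    also have "\<dots> \<le> card (X + B + C) + card ((X + B) - (X1 + B))"
      using card_Un_le card_image_le fin by (meson add_left_mono finite_Diff le_trans)
    also have "card ((X + B) - (X1 + B)) = card (X + B) - card (X1 + B)"
      using fin set_plus_mono2[OF sub(2) order_refl] by (intro card_Diff_subset) auto
    finally have up: "card (X + B + insert c C) \<le> card (X + B + C) + (card (X + B) - card (X1 + B))" .
    have le: "card (X1 + B) \<le> card (X + B)" "card X2 \<le> card X1" "card X2 \<le> card X"
      using sub fin finX set_plus_mono2[OF sub(2) order_refl] by (auto intro!: card_mono)
    have "card (X + C) + (card X - card X2) = card ((X + C) \<union> (\<lambda>x. x + c) ` (X - X2))"
      using fin finX sub
      by (subst card_Un_disjoint) (auto simp: X2_def card_image inj_on_def card_Diff_subset)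
    also have "\<dots> \<le> card (X + insert c C)"
      using finX insert.hyps
      by (intro card_mono finite_set_plus) (auto intro: set_plus_intro elim!: set_plus_elim)
    finally have low: "card (X + C) + (card X - card X2) \<le> card (X + insert c C)" .
    have "card (X + B + insert c C) * card X + card (X1 + B) * card X
        \<le> card (X + B + C) * card X + card (X + B) * card X"
    proof -
      have "card (X + B + insert c C) + card (X1 + B) \<le> card (X + B + C) + card (X + B)"
        using up le(1) by linarith
      from mult_le_mono1[OF this, of "card X"] show ?thesis by (simp add: add_mult_distrib)
    qed
    moreover have "card (X + B) * card X2 \<le> card (X1 + B) * card X"
      using ratio[of X1] sub X le by (meson le_trans mult_le_mono2 subset_trans)
    moreover have "card (X + B) * card (X + C) + card (X + B) * card X
        \<le> card (X + B) * card (X + insert c C) + card (X + B) * card X2"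
    proof -
      have "card (X + C) + card X \<le> card (X + insert c C) + card X2" using low le(3) by linarith
      then show ?thesis by (simp flip: distrib_left)
    qed
    ultimately show ?case using insert.IH by linarith
  qed
  then show thesis using that X ratio[of A] by blast
qed

text \<open>Petridis' subset \<open>X\<close> satisfies \<open>|X + B + B| \<le> K\<^sup>2 |X|\<close> for \<open>K = |A + B| / |A|\<close>, while
  injectivity forces \<open>|X + B + B| \<ge> |X| |B|\<close>.\<close>
lemma card_sumset_lower_bound:
  fixes A B :: "'a::ab_group_add set"
  assumes "finite A" "finite B" and inj: "inj_on (\<lambda>(a, b). a + (b + b)) (A \<times> B)"
  shows "card B * (card A)\<^sup>2 \<le> (card (A + B))\<^sup>2"
proof (cases "A = {}")
  case False
  obtain X where X: "X \<subseteq> A" "X \<noteq> {}" "card (X + B) * card A \<le> card (A + B) * card X"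
    and P: "\<And>C. finite C \<Longrightarrow> card (X + B + C) * card X \<le> card (X + B) * card (X + C)"
    using petridis[OF assms(1) False assms(2)] by metis
  have finX: "finite X" using X assms finite_subset by blast
  have cX: "card X > 0" using finX X by (simp add: card_gt_0_iff)
  have "card X * card B = card ((\<lambda>(a, b). a + (b + b)) ` (X \<times> B))"
    using inj X by (subst card_image) (auto intro: inj_on_subset simp: card_cartesian_product)
  also have "\<dots> \<le> card (X + B + B)"
    using finX assms
    by (intro card_mono finite_set_plus) (auto simp flip: add.assoc intro!: set_plus_intro)
  finally have "card X * card B * card X \<le> card (X + B + B) * card X" by (rule mult_le_mono1)
  \<comment> \<open>This is Petridis' inequality with \<open>C = B\<close>. The comparison of |X +
    B| / |X| with |A + B| / |A| then eliminates \<open>X\<close>.\<close>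
  also have "\<dots> \<le> (card (X + B))\<^sup>2" using P[OF assms(2)] by (simp add: power2_eq_square)
  finally have "card X * card B * card X \<le> (card (X + B))\<^sup>2" .
  then have "card X * card B * card X * (card A)\<^sup>2 \<le> (card (X + B))\<^sup>2 * (card A)\<^sup>2"
    by (rule mult_le_mono1)
  also have "\<dots> \<le> (card (A + B) * card X)\<^sup>2"
    using X(3) by (simp flip: power_mult_distrib)
  finally have "(card B * (card A)\<^sup>2) * (card X)\<^sup>2 \<le> (card (A + B))\<^sup>2 * (card X)\<^sup>2"
    by (simp add: power_mult_distrib power2_eq_square ac_simps)
  then show ?thesis using cX by simp
qed simp

section \<open>Paths of length four in dense bipartite graphs\<close>

text \<open>Gowers' graph lemma. \<open>S\<close> consists of the typical elements of the neighbourhood of a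
  well-chosen vertex \<open>y\<close>.\<close>
lemma many_paths_of_length_four:
  fixes E :: "('a \<times> 'b) set" and \<epsilon> :: real
  assumes "finite U" "finite W" "E \<subseteq> U \<times> W" and "\<epsilon> > 0" and "U \<noteq> {}" "W \<noteq> {}"
    and E: "real (card E) = \<epsilon> * card U * card W"
  obtains S where "S \<subseteq> U" "real (card S) \<ge> \<epsilon> * card U / 4"
    and "\<And>x x'. x \<in> S \<Longrightarrow> x' \<in> S \<Longrightarrow>
      real (card {(z, y, y') \<in> U \<times> W \<times> W. (x, y) \<in> E \<and> (z, y) \<in> E \<and> (z, y') \<in> E \<and> (x', y') \<in> E})
        \<ge> \<epsilon> ^ 5 * card U * (card W)\<^sup>2 / 1024"
proof -
  define u w where "u = real (card U)" and "w = real (card W)"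
  have uw: "u > 0" "w > 0" using assms by (auto simp: u_def w_def card_gt_0_iff)
  define N where "N y = {x. x \<in> U \<and> (x, y) \<in> E}" for y
  define M where "M x z = {y. y \<in> W \<and> (x, y) \<in> E \<and> (z, y) \<in> E}" for x z
  \<comment> \<open>Bad pairs have few common neighbours, so each lies in few neighbourhoods
    \<open>N y\<close>. Double counting leaves at most \<epsilon>^2 u^2 / 16 bad pairs per
    neighbourhood on average.\<close>
  define Bad where "Bad = {(x, z) \<in> U \<times> U. real (card (M x z)) \<le> \<epsilon>\<^sup>2 / 16 * w}"
  define bad where "bad y = {p. p \<in> Bad \<and> fst p \<in> N y \<and> snd p \<in> N y}" for y
  have fin: "finite (N y)" "finite (M x z)" "finite Bad" "finite (bad y)" for x y z
  proof -
    show "finite Bad" by (rule finite_subset[of _ "U \<times> U"]) (use assms in \<open>auto simp: Bad_def\<close>)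
    then show "finite (bad y)" by (simp add: bad_def)
  qed (use assms in \<open>auto simp: N_def M_def\<close>)
  have "E = (\<lambda>(y, x). (x, y)) ` Sigma W N" using assms by (auto simp: N_def image_iff split_def)
  then have "card E = card (Sigma W N)" by (simp add: card_image inj_on_def split_def prod_eq_iff)
  then have sumN: "(\<Sum>y\<in>W. real (card (N y))) = \<epsilon> * u * w"
    using E assms fin by (simp add: u_def w_def)
  have "(\<epsilon> * u * w)\<^sup>2 \<le> (\<Sum>y\<in>W. (real (card (N y)))\<^sup>2) * w"
    using sum_squared_le_sum_of_squares[of "\<lambda>y. real (card (N y))" W]
    by (simp add: sumN w_def)
  then have sq: "(\<Sum>y\<in>W. (real (card (N y)))\<^sup>2) \<ge> \<epsilon>\<^sup>2 * u\<^sup>2 * w"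
    using uw by (simp add: power2_eq_square field_simps)
  have "(\<Sum>y\<in>W. real (card (bad y))) = (\<Sum>p\<in>Bad. real (card {y. y \<in> W \<and> fst p \<in> N y \<and> snd p \<in> N y}))"
    using sum.swap_restrict[OF assms(2) fin(3), of "\<lambda>_ _. 1::real"] by (simp add: bad_def)
  also have "\<dots> \<le> (\<Sum>p\<in>Bad. \<epsilon>\<^sup>2 / 16 * w)"
  proof (rule sum_mono)
    fix p assume "p \<in> Bad"
    moreover from this have "{y. y \<in> W \<and> fst p \<in> N y \<and> snd p \<in> N y} = M (fst p) (snd p)"
      by (auto simp: Bad_def N_def M_def)
    ultimately show "real (card {y. y \<in> W \<and> fst p \<in> N y \<and> snd p \<in> N y}) \<le> \<epsilon>\<^sup>2 / 16 * w"
      by (auto simp: Bad_def)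
  qed
  also have "\<dots> = card Bad * (\<epsilon>\<^sup>2 / 16 * w)" by simp
  also have "\<dots> \<le> u\<^sup>2 * (\<epsilon>\<^sup>2 / 16 * w)"
  proof (rule mult_right_mono)
    have "card Bad \<le> card (U \<times> U)" using assms by (intro card_mono) (auto simp: Bad_def)
    then show "real (card Bad) \<le> u\<^sup>2"
      by (simp add: u_def power2_eq_square card_cartesian_product flip: of_nat_mult)
  qed (use uw in auto)
  finally have sumbad: "(\<Sum>y\<in>W. real (card (bad y))) \<le> u\<^sup>2 * (\<epsilon>\<^sup>2 / 16 * w)" .
  \<comment> \<open>The weight 8 uses up half of the second moment \<epsilon>^2 u^2 w. For the
    vertex \<open>y\<close> found by averaging, what remains forces both
    \<open>d >= \<epsilon> * u / 2\<close> and at most d^2 / 8 bad pairs inside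
    \<open>N y\<close>.\<close>
  have "(\<Sum>y\<in>W. (real (card (N y)))\<^sup>2 - 8 * real (card (bad y))) \<ge> (\<Sum>y\<in>W. \<epsilon>\<^sup>2 * u\<^sup>2 / 2)"
    unfolding sum_subtractf sum_distrib_left[symmetric] using sq sumbad by (simp add: w_def algebra_simps)
  then obtain y where y: "y \<in> W" "(real (card (N y)))\<^sup>2 - 8 * real (card (bad y)) \<ge> \<epsilon>\<^sup>2 * u\<^sup>2 / 2"
    using sum_strict_mono[OF assms(2,6)] by (meson not_less)
  define d where "d = real (card (N y))"
  have d: "d \<ge> \<epsilon> * u / 2"
  proof (rule power2_le_imp_le)
    show "(\<epsilon> * u / 2)\<^sup>2 \<le> d\<^sup>2"
      using y(2) by (simp add: d_def power_mult_distrib power_divide)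
        (smt (verit) of_nat_0_le_iff zero_le_mult_iff zero_le_power2)
  qed (simp add: d_def)
  then have d0: "d > 0" using \<open>\<epsilon> > 0\<close> uw by (smt (verit) divide_pos_pos mult_pos_pos)
  have bad: "real (card (bad y)) \<le> d\<^sup>2 / 8"
    using y(2) by (simp add: d_def) (smt (verit) zero_le_mult_iff zero_le_power2)
  define b where "b x = {z. z \<in> N y \<and> (x, z) \<in> Bad}" for x
  \<comment> \<open>By Markov's inequality at most half of \<open>N y\<close> has more than
    \<open>d / 4\<close> bad partners there.\<close>
  define S where "S = {x \<in> N y. real (card (b x)) \<le> d / 4}"
  have finb: "finite (b x)" for x using fin by (simp add: b_def)
  have "bad y = Sigma (N y) b" by (auto simp: bad_def b_def)
  then have "real (card (bad y)) = (\<Sum>x\<in>N y. real (card (b x)))" using fin finb by simp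
  also have "\<dots> \<ge> (\<Sum>x\<in>N y - S. d / 4)"
    using fin by (intro sum_le_included[where i = id]) (auto simp: S_def intro: less_imp_le)
  finally have "real (card (N y - S)) * (d / 4) \<le> d\<^sup>2 / 8" using bad by (simp add: mult.commute)
  then have "real (card (N y - S)) \<le> d / 2" using d0 by (simp add: power2_eq_square)
  moreover have "card (N y - S) = card (N y) - card S" "card S \<le> card (N y)"
    using fin by (auto simp: S_def intro!: card_Diff_subset card_mono)
  ultimately have S: "real (card S) \<ge> d / 2" by (simp add: d_def)
  show thesis
  proof
    show "S \<subseteq> U" by (auto simp: S_def N_def)
    show "real (card S) \<ge> \<epsilon> * card U / 4" using S d by (simp add: u_def)
    fix x x' assume xx: "x \<in> S" "x' \<in> S"
    \<comment> \<open>Middle vertices forming good pairs with both endpoints: at least d - d/4 - d/4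
      of them, each with at least \<epsilon>^2 w / 16 choices for \<open>y\<close> and as many for
      \<open>y'\<close>. The constant is 1024 = 4 * 16^2.\<close>
    define Z where "Z = N y - (b x \<union> b x')"
    have "real (card Z) \<ge> d - real (card (b x \<union> b x'))"
      using diff_card_le_card_Diff[of "b x \<union> b x'" "N y"] finb by (simp add: Z_def d_def)
    moreover have "real (card (b x \<union> b x')) \<le> real (card (b x)) + real (card (b x'))"
      using card_Un_le[of "b x" "b x'"] by linarith
    ultimately have Z: "real (card Z) \<ge> \<epsilon> * u / 4" using xx d by (simp add: S_def)
    let ?P = "{(z, y, y') \<in> U \<times> W \<times> W. (x, y) \<in> E \<and> (z, y) \<in> E \<and> (z, y') \<in> E \<and> (x', y') \<in> E}"
    have M: "real (card (M t z)) \<ge> \<epsilon>\<^sup>2 / 16 * w" if "z \<in> Z" "t = x \<or> t = x'" for z t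
      using that xx by (auto simp: Z_def b_def Bad_def S_def N_def)
    have "\<epsilon> ^ 5 * u * w\<^sup>2 / 1024 = (\<epsilon> * u / 4) * ((\<epsilon>\<^sup>2 / 16 * w) * (\<epsilon>\<^sup>2 / 16 * w))"
      by (simp add: power2_eq_square eval_nat_numeral)
    also have "\<dots> \<le> card Z * ((\<epsilon>\<^sup>2 / 16 * w) * (\<epsilon>\<^sup>2 / 16 * w))"
      using Z uw by (intro mult_right_mono) auto
    also have "\<dots> = (\<Sum>z\<in>Z. (\<epsilon>\<^sup>2 / 16 * w) * (\<epsilon>\<^sup>2 / 16 * w))" by simp
    also have "\<dots> \<le> (\<Sum>z\<in>Z. real (card (M x z)) * real (card (M x' z)))"
      using M uw by (intro sum_mono mult_mono) auto
    also have "\<dots> = real (card (Sigma Z (\<lambda>z. M x z \<times> M x' z)))"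
      using fin by (simp add: Z_def card_cartesian_product)
    also have "\<dots> \<le> real (card ?P)"
    proof -
      have "?P \<subseteq> U \<times> W \<times> W" by auto
      then have "finite ?P" using assms by (meson finite_SigmaI finite_subset)
      moreover have "Sigma Z (\<lambda>z. M x z \<times> M x' z) \<subseteq> ?P" by (auto simp: Z_def N_def M_def)
      ultimately show ?thesis by (simp add: card_mono)
    qed
    finally show "real (card ?P) \<ge> \<epsilon> ^ 5 * card U * (card W)\<^sup>2 / 1024" by (simp add: u_def w_def)
  qed
qed

section \<open>Small difference sets from many solutions\<close>

text \<open>A path \<open>x, y, z, y', x'\<close> of solutions expresses \<open>F x - F x'\<close> as an alternating sum of four
  values of \<open>H\<close>, whose arguments determine the path.\<close>
lemma card_solutions_bound:
  fixes F G H :: "'v::ab_group_add \<Rightarrow> 'w::ab_group_add" and \<epsilon> :: real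
  assumes V: "finite V" "V \<noteq> {}" "\<And>x y. x \<in> V \<Longrightarrow> y \<in> V \<Longrightarrow> x + y \<in> V"
    and inj: "inj_on (\<lambda>(x, y). F x - (F y + F y)) (V \<times> V)"
    and E: "E \<subseteq> V \<times> V" "\<And>x y. (x, y) \<in> E \<Longrightarrow> F x + G y + H (x + y) = 0"
    and \<epsilon>: "real (card E) = \<epsilon> * (card V)\<^sup>2"
  shows "\<epsilon> ^ 13 * card V \<le> 2 ^ 26"
proof (cases "\<epsilon> > 0")
  case True
  define N where "N = real (card V)"
  have N: "N > 0" using V by (simp add: N_def card_gt_0_iff)
  let ?P = "\<lambda>x x'. {(z, y, y') \<in> V \<times> V \<times> V. (x, y) \<in> E \<and> (z, y) \<in> E \<and> (z, y') \<in> E \<and> (x', y') \<in> E}"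
  obtain S where S: "S \<subseteq> V" "real (card S) \<ge> \<epsilon> * N / 4"
    and paths: "\<And>x x'. x \<in> S \<Longrightarrow> x' \<in> S \<Longrightarrow> real (card (?P x x')) \<ge> \<epsilon> ^ 5 * N * N\<^sup>2 / 1024"
  proof (rule many_paths_of_length_four[OF V(1) V(1) E(1) True V(2) V(2)])
    show "real (card E) = \<epsilon> * card V * card V" using \<epsilon> by (simp add: power2_eq_square)
  qed (auto simp: N_def)
  have finS: "finite S" using S V finite_subset by blast
  \<comment> \<open>On the diagonal, \<open>F x - (F x + F x)\<close> depends on \<open>F x\<close>
    alone, so \<open>inj\<close> already makes \<open>F\<close> injective.\<close>
  have injF: "inj_on F S"
  proof (rule inj_onI)
    fix x x' assume *: "x \<in> S" "x' \<in> S" "F x = F x'"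
    show "x = x'" using inj_onD[OF inj, of "(x, x)" "(x', x)"] * S by auto
  qed
  define A B where "A = F ` S" and "B = uminus ` F ` S"
  have cAB: "card A = card S" "card B = card S"
    using injF by (auto simp: A_def B_def card_image)
  have finAB: "finite A" "finite B" using finS by (auto simp: A_def B_def)
  \<comment> \<open>The sets \<open>Q d\<close> are disjoint for distinct \<open>d\<close> and lie
    in a set of size N^4. Many elements in each therefore bound the number of differences.\<close>
  define Q where "Q d = {(p, q, r, s) \<in> V \<times> V \<times> V \<times> V. H q - H p + H s - H r = d}" for d
  have "\<epsilon> ^ 5 * N ^ 3 / 1024 \<le> real (card (Q d))" if "d \<in> A + B" for d
  proof -
    obtain x x' where x: "x \<in> S" "x' \<in> S" "d = F x - F x'"
    proof -
      obtain a b where "a \<in> A" "b \<in> B" "d = a + b" using \<open>d \<in> A + B\<close> by (rule set_plus_elim)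
      then show thesis using that by (auto simp: A_def B_def)
    qed
    let ?h = "\<lambda>(z, y, y'). (x + y, z + y, z + y', x' + y')"
    have "finite (Q d)"
      by (rule finite_subset[of _ "V \<times> V \<times> V \<times> V"]) (use V in \<open>auto simp: Q_def\<close>)
    moreover have "?h ` ?P x x' \<subseteq> Q d"
    proof clarify
      fix z y y' assume *: "z \<in> V" "y \<in> V" "y' \<in> V"
        "(x, y) \<in> E" "(z, y) \<in> E" "(z, y') \<in> E" "(x', y') \<in> E"
      have e: "F a = - G b - H (a + b)" if "(a, b) \<in> E" for a b
        using E(2)[OF that] by (simp add: algebra_simps eq_neg_iff_add_eq_0)
      have "d = (F x - F z) + (F z - F x')" using x by simp
      also have "F x - F z = H (z + y) - H (x + y)"
        using e[OF *(4)] e[OF *(5)] by simp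
      also have "F z - F x' = H (x' + y') - H (z + y')"
        using e[OF *(6)] e[OF *(7)] by simp
      finally have "H (z + y) - H (x + y) + H (x' + y') - H (z + y') = d" by simp
      then show "(x + y, z + y, z + y', x' + y') \<in> Q d"
        using * x S V(3) by (auto simp: Q_def)
    qed
    \<comment> \<open>Since \<open>x\<close> and \<open>x'\<close> are fixed, the entries reveal
      first \<open>y\<close>, then \<open>z\<close>, and the last one \<open>y'\<close>.\<close>
    moreover have "inj_on ?h (?P x x')" by (auto simp: inj_on_def)
    ultimately have "card (?P x x') \<le> card (Q d)" by (intro card_inj_on_le)
    then show ?thesis using paths[OF x(1,2)] by (simp add: power2_eq_square power3_eq_cube mult.assoc)
  qed
  then have "(\<Sum>d\<in>A + B. \<epsilon> ^ 5 * N ^ 3 / 1024) \<le> (\<Sum>d\<in>A + B. real (card (Q d)))"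
    by (rule sum_mono)
  also have "\<dots> = real (card (\<Union>d\<in>A + B. Q d))"
  proof -
    have "finite (Q d)" for d
      by (rule finite_subset[of _ "V \<times> V \<times> V \<times> V"]) (use V in \<open>auto simp: Q_def\<close>)
    then show ?thesis
      by (subst card_UN_disjoint) (auto simp: Q_def finAB finite_set_plus)
  qed
  also have "\<dots> \<le> real (card (V \<times> V \<times> V \<times> V))"
    using V by (intro of_nat_mono card_mono) (auto simp: Q_def)
  also have "\<dots> = N ^ 4" by (simp add: N_def card_cartesian_product eval_nat_numeral)
  finally have "(real (card (A + B)) * \<epsilon> ^ 5 / 1024) * N ^ 3 \<le> N * N ^ 3"
    by (simp add: eval_nat_numeral)
  then have D: "real (card (A + B)) * \<epsilon> ^ 5 \<le> 1024 * N" using N by simp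
  have "inj_on (\<lambda>(a, b). a + (b + b)) (A \<times> B)"
  proof (rule inj_onI)
    fix p q assume "p \<in> A \<times> B" "q \<in> A \<times> B" and eq: "(\<lambda>(a, b). a + (b + b)) p = (\<lambda>(a, b). a + (b + b)) q"
    then obtain x y x' y' where p: "x \<in> S" "y \<in> S" "p = (F x, - F y)"
      and q: "x' \<in> S" "y' \<in> S" "q = (F x', - F y')" by (auto simp: A_def B_def)
    have "F x - (F y + F y) = F x' - (F y' + F y')" using eq p q by (simp add: algebra_simps)
    then show "p = q" using inj_onD[OF inj, of "(x, y)" "(x', y')"] p q S by auto
  qed
  from card_sumset_lower_bound[OF finAB this] have "card S ^ 3 \<le> (card (A + B))\<^sup>2"
    by (simp add: cAB power2_eq_square power3_eq_cube)
  then have "real (card S) ^ 3 \<le> (real (card (A + B)))\<^sup>2" by (metis of_nat_le_iff of_nat_power)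
  \<comment> \<open>Squaring \<open>D\<close> costs \<epsilon>^10 and 1024^2 = 2^20; the cube of |S|
    >= \<epsilon> N / 4 costs \<epsilon>^3 and 2^6. This is the origin of 13 and 26.\<close>
  then have "real (card S) ^ 3 * \<epsilon> ^ 10 \<le> (real (card (A + B)))\<^sup>2 * \<epsilon> ^ 10"
    using True by (intro mult_right_mono) auto
  also have "\<dots> = (real (card (A + B)) * \<epsilon> ^ 5)\<^sup>2" by (simp add: power_mult_distrib flip: power_mult)
  also have "\<dots> \<le> (1024 * N)\<^sup>2" using D True by (intro power_mono) auto
  finally have "real (card S) ^ 3 * \<epsilon> ^ 10 \<le> (1024 * N)\<^sup>2" .
  moreover have "(\<epsilon> * N / 4) ^ 3 * \<epsilon> ^ 10 \<le> real (card S) ^ 3 * \<epsilon> ^ 10"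
    using S True N by (intro mult_right_mono power_mono) auto
  ultimately have "(\<epsilon> * N / 4) ^ 3 * \<epsilon> ^ 10 \<le> (1024 * N)\<^sup>2" by linarith
  then have "(\<epsilon> ^ 13 * N) * N\<^sup>2 \<le> 2 ^ 26 * N\<^sup>2"
    by (simp add: power_mult_distrib power_divide field_simps eval_nat_numeral)
  then have "\<epsilon> ^ 13 * N \<le> 2 ^ 26" using N by (subst (asm) mult_le_cancel_right) auto
  then show ?thesis by (simp add: N_def)
next
  case False
  \<comment> \<open>The exponent 13 is odd.\<close>
  have "\<epsilon> ^ 13 \<le> 0" using False by (simp add: power_le_zero_eq)
  then show ?thesis by (smt (verit) mult_nonpos_nonneg of_nat_0_le_iff zero_le_power)
qed

section \<open>Encoding the game modulo 4\<close>

text \<open>Since \<open>q\<^sub>1 + q\<^sub>2 + q\<^sub>3\<close> is even, \<open>q\<^sub>1 \<or> q\<^sub>2 \<or> q\<^sub>3\<close> is half of the integer sum, so the winning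
  condition is linear over the integers mod 4.\<close>
definition z4_code :: "bit \<Rightarrow> bit \<Rightarrow> 4" where
  "z4_code a q = 2 * of_bool (a = 1) - of_bool (q = 1)"

lemma z4_code_sum_eq_0:
  assumes "(q1, q2, q3) \<in> {(0, 0, 0), (0, 1, 1), (1, 0, 1), (1, 1, 0)}"
    and "a1 + a2 + a3 = of_bool (q1 = 1 \<or> q2 = 1 \<or> q3 = 1)"
  shows "z4_code a1 q1 + z4_code a2 q2 + z4_code a3 q3 = 0"
  using assms by (cases a1; cases a2; cases a3) (auto simp: z4_code_def)

lemma z4_code_double: "2 * z4_code b r = (if r = 1 then 2 else 0)"
  by (cases b; cases r) (simp_all add: z4_code_def)

lemma z4_code_double_inj:
  assumes "2 * z4_code b r = 2 * z4_code b' r'"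
  shows "r = r'"
  using assms by (cases r; cases r') (simp_all add: z4_code_double)

text \<open>Doubling annihilates the second term, as 4 = 0, and keeps only the parity of the first,
  which reveals the query bit whatever the answers are.\<close>

lemma z4_code_diff_double_inj:
  assumes "z4_code a q - 2 * z4_code b r = z4_code a' q' - 2 * z4_code b' r'"
  shows "q = q'"
proof -
  define m where "m = z4_code a q - 2 * z4_code b r"
  have "m + m = (if q = 1 then 2 else 0)"
    unfolding m_def z4_code_double[of b r] by (cases a; cases q) (simp_all add: z4_code_def)
  moreover have "m + m = (if q' = 1 then 2 else 0)"
    unfolding m_def assms z4_code_double[of b' r'] by (cases a'; cases q') (simp_all add: z4_code_def)
  ultimately show ?thesis by (cases q; cases q') simp_all
qed

text \<open>The first two players' inputs determine the query, so winning queries become pairs in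
  \<open>V \<times> V\<close>. Since 4^n = |V|^2, the winning probability is exactly the density
  \<epsilon> of solutions.\<close>

lemma win_prob_GHZ_rep_bound:
  "(win_prob (parallel_rep n GHZ) f1 f2 f3) ^ 13 * 2 ^ n \<le> 2 ^ 26"
proof -
  define Q :: "(bit \<times> bit \<times> bit) set" where "Q = {(0, 0, 0), (0, 1, 1), (1, 0, 1), (1, 1, 0)}"
  define R where "R = PiE_dflt {..<n} undefined (\<lambda>_. Q)"
  define ask :: "(nat \<Rightarrow> bit \<times> bit \<times> bit) \<Rightarrow> _"
    where "ask q = (\<lambda>i\<in>{..<n}. fst (q i), \<lambda>i\<in>{..<n}. fst (snd (q i)), \<lambda>i\<in>{..<n}. snd (snd (q i)))" for q
  define W where "W = {q \<in> R. case ask q of (q1, q2, q3) \<Rightarrow>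
    wins (parallel_rep n GHZ) (q1, q2, q3) (f1 q1, f2 q2, f3 q3)}"
  have Q: "finite Q" "Q \<noteq> {}" "card Q = 4" by (auto simp: Q_def)
  have R: "finite R" "R \<noteq> {}" "card R = 4 ^ n" using Q by (auto simp: R_def card_PiE_dflt)
  have "query_dist (parallel_rep n GHZ) = map_pmf ask (pmf_of_set R)"
    using Q by (simp add: parallel_rep_def GHZ_def ask_def[abs_def] R_def Pi_pmf_of_set flip: Q_def)
  then have "win_prob (parallel_rep n GHZ) f1 f2 f3 = real (card W) / 4 ^ n"
    using R by (simp add: win_prob_def measure_pmf_of_set W_def vimage_def Int_def split_def)
  then have prob: "real (card W) = win_prob (parallel_rep n GHZ) f1 f2 f3 * (2 ^ n)\<^sup>2"
    using power_mult_distrib[of "2::real" 2 n] by (simp add: power2_eq_square)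

  \<comment> \<open>The default is 0 here, not \<open>undefined\<close> as in \<open>R\<close>, so
    that \<open>V\<close> is closed under pointwise addition.\<close>
  define V where "V = PiE_dflt {..<n} 0 (\<lambda>_. UNIV :: bit set)"
  have "UNIV = {0, 1 :: bit}" by (auto intro: bit.exhaust)
  then have "finite (UNIV :: bit set)" "card (UNIV :: bit set) = 2"
    by (metis finite.emptyI finite_insert, metis card_2_iff zero_neq_one)
  then have V: "finite V" "card V = 2 ^ n" by (auto simp: V_def card_PiE_dflt)
  define pad :: "(nat \<Rightarrow> bit) \<Rightarrow> nat \<Rightarrow> bit" where "pad x i = (if i < n then x i else 0)" for x i
  \<comment> \<open>Restricting \<open>x\<close> turns the zero-padded vector back into a legal
    input of the player; the value 0 beyond \<open>n\<close> makes the linear equation hold there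
    trivially.\<close>
  define code where "code f x i = (if i < n then z4_code (f (restrict x {..<n}) i) (x i) else 0)"
    for f :: "(nat \<Rightarrow> bit) \<Rightarrow> nat \<Rightarrow> bit" and x i
  define split where "split q = (pad (\<lambda>i. fst (q i)), pad (\<lambda>i. fst (snd (q i))))"
    for q :: "nat \<Rightarrow> bit \<times> bit \<times> bit"
  have RQ: "fst (q i) = q1 \<and> fst (snd (q i)) = q2 \<Longrightarrow> q i = (q1, q2, q1 + q2)" "q i \<in> Q"
    if "q \<in> R" "i < n" for q i q1 q2
  proof -
    show "q i \<in> Q" using that by (auto simp: R_def PiE_dflt_def)
    then show "fst (q i) = q1 \<and> fst (snd (q i)) = q2 \<Longrightarrow> q i = (q1, q2, q1 + q2)"
      by (auto simp: Q_def)
  qed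
  have "inj_on split R"
  proof (rule inj_onI, rule ext)
    fix q q' i assume q: "q \<in> R" "q' \<in> R" "split q = split q'"
    show "q i = q' i"
    proof (cases "i < n")
      case True
      with q(3) have "fst (q i) = fst (q' i)" "fst (snd (q i)) = fst (snd (q' i))"
        by (auto simp: split_def pad_def fun_eq_iff dest: spec[of _ i])
      then show ?thesis using RQ(1)[OF q(1) True] RQ(1)[OF q(2) True] by metis
    next
      case False
      then show ?thesis using q by (auto simp: R_def PiE_dflt_def)
    qed
  qed
  then have cardW: "card (split ` W) = card W"
    by (intro card_image) (auto simp: W_def inj_on_def)
  have "(win_prob (parallel_rep n GHZ) f1 f2 f3) ^ 13 * card V \<le> 2 ^ 26"
  proof (rule card_solutions_bound[of V "code f1" "split ` W" "code f2" "code f3"])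
    show "finite V" "V \<noteq> {}" using V by auto
    show "x + y \<in> V" if "x \<in> V" "y \<in> V" for x y using that by (auto simp: V_def PiE_dflt_def)
    show "split ` W \<subseteq> V \<times> V" by (auto simp: split_def pad_def V_def PiE_dflt_def)
    show "real (card (split ` W)) = win_prob (parallel_rep n GHZ) f1 f2 f3 * (card V)\<^sup>2"
      using prob by (simp add: cardW V)
    show "inj_on (\<lambda>(x, y). code f1 x - (code f1 y + code f1 y)) (V \<times> V)"
    proof (rule inj_onI)
      fix p q assume pq: "p \<in> V \<times> V" "q \<in> V \<times> V"
        and eq: "(\<lambda>(x, y). code f1 x - (code f1 y + code f1 y)) p
               = (\<lambda>(x, y). code f1 x - (code f1 y + code f1 y)) q"
      obtain x y x' y' where p: "p = (x, y)" "q = (x', y')" by (cases p, cases q) auto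
      have eqi: "(code f1 x - (code f1 y + code f1 y)) i = (code f1 x' - (code f1 y' + code f1 y')) i" for i
        using eq p by simp
      have out: "x i = x' i" "y i = y' i" if "\<not> i < n" for i
        using pq p that by (auto simp: V_def PiE_dflt_def)
      have "x i = x' i" for i
      proof (cases "i < n")
        case True
        then show ?thesis using eqi[of i] by (auto simp: code_def dest!: z4_code_diff_double_inj)
      qed (rule out)
      then have x: "x = x'" by auto
      \<comment> \<open>All of \<open>x = x'\<close> is needed first: an answer bit depends on the
        whole input, and only then do the terms \<open>code f1 x\<close> cancel and leave the
        doubled code of \<open>y\<close>.\<close>
      have "y i = y' i" for i
      proof (cases "i < n")
        case True
        then show ?thesis using eqi[of i] x by (auto simp: code_def dest!: z4_code_double_inj)
      qed (rule out)
      then have "y = y'" by auto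
      then show "p = q" using p x by simp
    qed
    fix x y assume "(x, y) \<in> split ` W"
    then obtain q where q: "q \<in> W" "split q = (x, y)" by auto
    then have qR: "q \<in> R" by (simp add: W_def)
    have qi: "q i = (x i, y i, x i + y i)" if "i < n" for i
      using q(2) that by (intro RQ(1)[OF qR that]) (auto simp: split_def pad_def)
    have ask: "ask q = (restrict x {..<n}, restrict y {..<n}, restrict (x + y) {..<n})"
      by (auto simp: ask_def qi intro!: restrict_ext)
    have "(code f1 x + code f2 y + code f3 (x + y)) i = 0" for i
    proof (cases "i < n")
      case True
      show ?thesis using True q(1) RQ(2)[OF qR True]
        by (auto simp: code_def W_def ask parallel_rep_def GHZ_def qi Q_def intro!: z4_code_sum_eq_0)
    qed (simp add: code_def)
    then show "code f1 x + code f2 y + code f3 (x + y) = 0" by auto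
  qed
  then show ?thesis by (simp add: V)
qed

section \<open>From exponential to polynomial decay\<close>

theorem theorem1p1:
  shows "\<exists>c::real. c > 0 \<and> (\<exists>n0::nat. \<forall>n\<ge>n0.
    game_value (parallel_rep n GHZ) \<le> real n powr (- c))"
proof -
  \<comment> \<open>The threshold 32 works because 32 < 2^6 = 2^(32 - 26). The exponent 1/13 below
    comes from the 13th root of v^13 <= 2^(26 - n) <= 1/n.\<close>
  have big: "n < 2 ^ (n - 26)" if "n \<ge> 32" for n :: nat
  proof -
    have "m + 32 < 2 ^ 6 * 2 ^ m" for m :: nat by (induction m) simp_all
    then have "n - 32 + 32 < 2 ^ (6 + (n - 32))" by (simp only: power_add)
    moreover have "6 + (n - 32) = n - 26" "n - 32 + 32 = n" using that by simp_all
    ultimately show ?thesis by (simp only:)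
  qed
  have "game_value (parallel_rep n GHZ) \<le> real n powr (- (1 / 13))" if n: "n \<ge> 32" for n
  proof -
    obtain f1 f2 f3 where f: "game_value (parallel_rep n GHZ) = win_prob (parallel_rep n GHZ) f1 f2 f3"
      using game_value_GHZ_rep_attained by blast
    define v where "v = win_prob (parallel_rep n GHZ) f1 f2 f3"
    have pow: "(2::real) ^ n = 2 ^ 26 * 2 ^ (n - 26)" using power_add[of "2::real" 26 "n - 26"] n by simp
    have "2 ^ 26 * (v ^ 13 * 2 ^ (n - 26)) \<le> 2 ^ 26 * 1"
      using win_prob_GHZ_rep_bound[of n f1 f2 f3] by (simp only: v_def pow mult_ac mult_1_right)
    then have "v ^ 13 * 2 ^ (n - 26) \<le> 1" by (subst (asm) mult_le_cancel_left_pos) simp_all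
    then have "v ^ 13 \<le> 1 / 2 ^ (n - 26)" by (simp add: pos_le_divide_eq)
    also have "\<dots> \<le> 1 / real n"
      using big[OF n] n by (intro divide_left_mono) simp_all
    also have "\<dots> = (real n powr (- (1 / 13))) ^ 13"
      using n powr_power[of "real n" "- (1 / 13)" 13] by (simp add: powr_minus_divide)
    finally show ?thesis
      using power_le_imp_le_base[of v 12 "real n powr (- (1 / 13))"] by (simp add: f v_def)
  qed
  then show ?thesis by (intro exI[of _ "1 / 13"] conjI exI[of _ 32]) auto
qed

end
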